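(* Let $n, m$ be positive integers, $\tau>0$, let $\lambda_0$ and $A$ be real numbers, and let $$\Delta(\lambda) = \frac{\tau^m (\lambda-\lambda_0)^{n+m}}{(m-1)!} \int_0^1 t^{m-1}(1-t)^{n-1}(1-At)\,\mathrm{e}^{-t\tau(\lambda-\lambda_0)}\,\mathrm{d}t, \qquad \lambda\in\mathbb{C}.$$ Let $F$ and $G$ be the functions defined in the context for the parameters $$(a,b,\alpha,\beta) = \left(m,\; n+m,\; \frac{(1-A)(n-1)!}{(n+m-1)!},\; \frac{A\,n!}{(n+m)!}\right).$$ Assume that, for every $t\in(0,1)$ and every root $z$ of $F$ with $\Re(z)<0$, one has $\Re[z\,G(tz)]\geq 0$. Then $\lambda_0$ is a dominant root of $\Delta$, i.e. every root $\lambda\in\mathbb{C}$ of $\Delta$ satisfies $\Re(\lambda)\leq\lambda_0$; in other words, $\lambda_0$ satisfies the MID property.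
   Context: $\mathbb{N} = \{0,1,2,\dots\}$. For $x\in\mathbb{C}$ and $k \in \mathbb{N}$, the Pochhammer symbol is defined by $(x)_0 = 1$ and $(x)_{k+1} = (x+k)(x)_k$. For $a,b\in\mathbb{C}$ with $-b\notin\mathbb{N}$, the Kummer confluent hypergeometric function is the entire function $\Phi(a,b,z) = \sum_{k=0}^\infty \frac{(a)_k}{(b)_k}\frac{z^k}{k!}$. For given parameters $(a,b,\alpha,\beta)$ define $$F(z) = \alpha\,\Phi(a,b,z) + \beta\,\Phi(a,b+1,z),$$ $$D(z) = \left((a-b)\alpha^2 - \alpha b \beta\right) z - \alpha b^2 \beta - b^2 \beta^2,$$ $$N(z) = a\left(\left((a-b)\alpha^2 - \alpha b\beta\right) z - \beta b (b+1)\alpha\right) - a b^2 \beta^2,$$ $$Q(z) = -1 + \frac{b+1}{z} - \frac{\alpha(a\alpha - \alpha b - \beta b)}{D(z)}, \qquad R(z) = -\frac{N(z)}{z\,D(z)},$$ $$G(z) = R(z) - \frac{Q(z)^2}{4} - \frac12 Q'(z),$$ where $Q$, $R$, $G$ are defined at the points $z\neq 0$ with $D(z)\neq 0$; the inequality $\Re[z\,G(tz)]\ge 0$ is understood to include that $G$ is defined at $tz$. MID (multiplicity induced dominancy) property: a root $\lambda_0$ of $\Delta$ satisfies the MID property if its multiplicity is larger than one and it is dominant, i.e. all roots $\lambda$ of $\Delta$ satisfy $\Re(\lambda)\le\Re(\lambda_0)$. *)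

theory Defs
  imports "HOL-Complex_Analysis.Complex_Analysis"
begin

text \<open>The parameter \<open>b\<close> must not be a nonpositive integer; otherwise some denominators vanish and
  the value is meaningless.\<close>
definition kummer_Phi :: "complex \<Rightarrow> complex \<Rightarrow> complex \<Rightarrow> complex" where
  "kummer_Phi a b z = (\<Sum>k. pochhammer a k / pochhammer b k * (z ^ k / fact k))"

definition comb_F :: "complex \<Rightarrow> complex \<Rightarrow> complex \<Rightarrow> complex \<Rightarrow> complex \<Rightarrow> complex" where
  "comb_F a b \<alpha> \<beta> z = \<alpha> * kummer_Phi a b z + \<beta> * kummer_Phi a (b + 1) z"

definition coeff_D :: "complex \<Rightarrow> complex \<Rightarrow> complex \<Rightarrow> complex \<Rightarrow> complex \<Rightarrow> complex" where
  "coeff_D a b \<alpha> \<beta> z =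
     ((a - b) * \<alpha>\<^sup>2 - \<alpha> * b * \<beta>) * z - \<alpha> * b\<^sup>2 * \<beta> - b\<^sup>2 * \<beta>\<^sup>2"

definition coeff_N :: "complex \<Rightarrow> complex \<Rightarrow> complex \<Rightarrow> complex \<Rightarrow> complex \<Rightarrow> complex" where
  "coeff_N a b \<alpha> \<beta> z =
     a * (((a - b) * \<alpha>\<^sup>2 - \<alpha> * b * \<beta>) * z - \<beta> * b * (b + 1) * \<alpha>) - a * b\<^sup>2 * \<beta>\<^sup>2"

text \<open>The functions \<open>coeff_Q\<close>, \<open>coeff_R\<close> and \<open>coeff_G\<close> are meaningful only on \<open>coeff_dom\<close>; elsewhere
  their values are artefacts of division by zero.\<close>
definition coeff_dom :: "complex \<Rightarrow> complex \<Rightarrow> complex \<Rightarrow> complex \<Rightarrow> complex set" where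
  "coeff_dom a b \<alpha> \<beta> = {z. z \<noteq> 0 \<and> coeff_D a b \<alpha> \<beta> z \<noteq> 0}"

definition coeff_Q :: "complex \<Rightarrow> complex \<Rightarrow> complex \<Rightarrow> complex \<Rightarrow> complex \<Rightarrow> complex" where
  "coeff_Q a b \<alpha> \<beta> z =
     - 1 + (b + 1) / z - \<alpha> * (a * \<alpha> - \<alpha> * b - \<beta> * b) / coeff_D a b \<alpha> \<beta> z"

definition coeff_R :: "complex \<Rightarrow> complex \<Rightarrow> complex \<Rightarrow> complex \<Rightarrow> complex \<Rightarrow> complex" where
  "coeff_R a b \<alpha> \<beta> z = - (coeff_N a b \<alpha> \<beta> z / (z * coeff_D a b \<alpha> \<beta> z))"

definition coeff_G :: "complex \<Rightarrow> complex \<Rightarrow> complex \<Rightarrow> complex \<Rightarrow> complex \<Rightarrow> complex" where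
  "coeff_G a b \<alpha> \<beta> z =
     coeff_R a b \<alpha> \<beta> z - (coeff_Q a b \<alpha> \<beta> z)\<^sup>2 / 4 - 1 / 2 * deriv (coeff_Q a b \<alpha> \<beta>) z"

definition dominant_root :: "(complex \<Rightarrow> complex) \<Rightarrow> complex \<Rightarrow> bool" where
  "dominant_root f z0 \<longleftrightarrow> f z0 = 0 \<and> (\<forall>z. f z = 0 \<longrightarrow> Re z \<le> Re z0)"

text \<open>For an entire function that is not identically zero, \<open>zorder\<close> at a root is the multiplicity of
  that root. The second conjunct excludes the zero function, for which \<open>zorder\<close> is unspecified.\<close>
definition MID_property :: "(complex \<Rightarrow> complex) \<Rightarrow> complex \<Rightarrow> bool" where
  "MID_property f z0 \<longleftrightarrow>
     dominant_root f z0 \<and> (\<exists>\<^sub>F z in at z0. f z \<noteq> 0) \<and> zorder f z0 > 1"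

definition char_Delta :: "nat \<Rightarrow> nat \<Rightarrow> real \<Rightarrow> real \<Rightarrow> real \<Rightarrow> complex \<Rightarrow> complex" where
  "char_Delta n m \<tau> s0 A s =
     of_real \<tau> ^ m * (s - of_real s0) ^ (n + m) / fact (m - 1) *
     integral {0..1} (\<lambda>t::real.
       of_real (t ^ (m - 1) * (1 - t) ^ (n - 1) * (1 - A * t)) *
       exp (- (of_real t * of_real \<tau> * (s - of_real s0))))"

end

theory Submission
  imports Defs
begin

text \<open>Since \<open>1 - A t = (1 - A) + A (1 - t)\<close>, the integral in \<open>\<Delta>\<close> is a combination of two integral
  representations of Kummer's function, and \<open>\<Delta>(s)\<close> is \<open>(s - s\<^sub>0)\<^bsup>n+m\<^esup>\<close> times a nonzero constant
  times \<open>F(- \<tau> (s - s\<^sub>0))\<close> (\<open>char_Delta_conv_comb_F\<close>). The power makes \<open>s\<^sub>0\<close> a root of multiplicity at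
  least \<open>n + m\<close>, and a root to the right of \<open>s\<^sub>0\<close> is a root of \<open>F\<close> with negative real part. So the
  theorem says that \<open>F\<close> has no root in the open left half plane (\<open>comb_F_no_left_root\<close>).

  Both Kummer functions in \<open>F\<close> are linear combinations of \<open>\<Psi> = \<Phi>(a, b + 1, \<cdot>)\<close> and \<open>\<Psi>'\<close>, so \<open>F\<close> solves
  a second-order linear equation, \<open>F'' + Q F' + R F = 0\<close> (\<open>comb_F_normalized_ode\<close>). Let \<open>S\<close> be a function
  with \<open>S' = Q S / 2\<close>; then \<open>f = F S\<close> satisfies \<open>f'' + G f = 0\<close>. Let \<open>z\<close> be a root of \<open>F\<close> with
  \<open>Re z < 0\<close>, and put \<open>\<phi>(t) = f(t z)\<close>. Integrating \<open>\<phi>'' + z\<^sup>2 G(t z) \<phi> = 0\<close> against the conjugate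
  of \<open>\<phi>\<close> over \<open>[0, 1]\<close>, where the boundary terms vanish, and dividing by \<open>z\<close> gives
  \[ \frac{1}{z} \int_0^1 |\phi'(t)|^2\,dt = \int_0^1 z\,G(tz)\,|\phi(t)|^2\,dt . \]
  The real part of the right-hand side is nonnegative by hypothesis, while \<open>Re (1 / z) < 0\<close>. Hence
  \<open>\<phi>' = 0\<close>, and \<open>\<phi>\<close> vanishes because it tends to \<open>0\<close> at \<open>0\<close>. Then \<open>F\<close> vanishes on a segment, hence
  everywhere, which is impossible (\<open>comb_F_not_identically_zero\<close>).

  The function \<open>S(t z)\<close> is \<open>exp (- t z / 2) (t z)\<^bsup>(b+1)/2\<^esup> D(t z)\<^bsup>-1/2\<^esup>\<close> and would need branches of roots.
  Only its squared modulus enters the identity, so the formal argument works with the weight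
  \<open>w(t)\<close> that is this squared modulus up to a constant factor, with \<open>v(t) = F(t z)\<close> and with \<open>u = F' + Q F / 2\<close> at \<open>t z\<close>, for which \<open>u S = f'\<close>. It also
  replaces integration by monotonicity of the boundary term (\<open>energy_argument\<close>).\<close>

section \<open>Kummer's function\<close>

definition kummer_fps :: "complex \<Rightarrow> complex \<Rightarrow> complex fps" where
  "kummer_fps a b = Abs_fps (\<lambda>k. pochhammer a k / (pochhammer b k * fact k))"

lemma kummer_fps_conv_radius [simp]: "fps_conv_radius (kummer_fps a b) = \<infinity>"
  unfolding fps_conv_radius_def
proof (rule conv_radius_inftyI'')
  fix z :: complex
  define c where "c k = fps_nth (kummer_fps a b) k * z ^ k" for k
  have "(\<lambda>k. (a + of_nat k) / (b + of_nat k) * (z / of_nat (Suc k))) \<longlonglongrightarrow> 1 * 0"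
  proof (rule tendsto_mult)
    show "(\<lambda>k. (a + of_nat k) / (b + of_nat k)) \<longlonglongrightarrow> 1"
    proof (rule Lim_transform_eventually)
      have "(\<lambda>k. 1 + (a - b) / (b + of_nat k)) \<longlonglongrightarrow> 1 + 0"
        by (intro tendsto_intros tendsto_divide_0[OF tendsto_const]
              tendsto_add_filterlim_at_infinity[OF tendsto_const] tendsto_of_nat)
      thus "(\<lambda>k. 1 + (a - b) / (b + of_nat k)) \<longlonglongrightarrow> 1" by simp
      have "filterlim (\<lambda>k. b + of_nat k) at_infinity sequentially"
        by (intro tendsto_add_filterlim_at_infinity[OF tendsto_const] tendsto_of_nat)
      hence "eventually (\<lambda>k. b + of_nat k \<noteq> 0) sequentially"
        by (rule filterlim_at_infinity_imp_eventually_ne)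
      thus "eventually (\<lambda>k. 1 + (a - b) / (b + of_nat k) = (a + of_nat k) / (b + of_nat k)) sequentially"
        by eventually_elim (simp add: field_simps)
    qed
    show "(\<lambda>k. z / of_nat (Suc k)) \<longlonglongrightarrow> 0"
      using LIMSEQ_Suc[OF lim_const_over_n[of z]] .
  qed
  hence "eventually (\<lambda>k. norm ((a + of_nat k) / (b + of_nat k) * (z / of_nat (Suc k))) < 1/2) sequentially"
    by (auto dest!: tendstoD[where e = "1/2"] simp: dist_norm simp del: of_nat_Suc)
  then obtain K where K: "norm ((a + of_nat k) / (b + of_nat k) * (z / of_nat (Suc k))) < 1/2"
    if "k \<ge> K" for k by (auto simp: eventually_sequentially)
  have step: "c (Suc k) = (a + of_nat k) / (b + of_nat k) * (z / of_nat (Suc k)) * c k" for k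
    by (simp add: c_def kummer_fps_def pochhammer_Suc ac_simps del: of_nat_Suc)
  have "summable c"
  proof (rule summable_ratio_test[where c = "1/2" and N = K])
    show "norm (c (Suc k)) \<le> 1/2 * norm (c k)" if "k \<ge> K" for k
      unfolding step norm_mult[of _ "c k"] using K[OF that] by (intro mult_right_mono) auto
  qed simp
  thus "summable (\<lambda>k. fps_nth (kummer_fps a b) k * z ^ k)"
    unfolding c_def[abs_def] .
qed

lemma pochhammer_nonzero:
  fixes b :: complex
  assumes "\<And>k. b + of_nat k \<noteq> 0"
  shows "pochhammer b k \<noteq> 0"
  by (induction k) (simp_all add: pochhammer_Suc assms)

lemma kummer_Phi_conv_eval_fps: "kummer_Phi a b = eval_fps (kummer_fps a b)"
  by (simp add: fun_eq_iff kummer_Phi_def eval_fps_def kummer_fps_def divide_divide_eq_left)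

lemma kummer_Phi_holomorphic: "kummer_Phi a b holomorphic_on S"
  unfolding kummer_Phi_conv_eval_fps by (intro holomorphic_intros) auto

text \<open>Kummer's equation: on coefficients it is the recurrence
  \<open>(k + 1) (b + k) c\<^bsub>k+1\<^esub> = (a + k) c\<^bsub>k\<^esub>\<close>.\<close>
lemma kummer_Phi_ode:
  assumes "\<And>k. b + of_nat k \<noteq> 0"
  shows "z * deriv (deriv (kummer_Phi a b)) z + (b - z) * deriv (kummer_Phi a b) z
           = a * kummer_Phi a b z"
proof -
  define f where "f = kummer_fps a b"
  have r: "fps_conv_radius f = \<infinity>" "fps_conv_radius (fps_deriv f) = \<infinity>"
    "fps_conv_radius (fps_deriv (fps_deriv f)) = \<infinity>"
    using fps_conv_radius_deriv[of f] fps_conv_radius_deriv[of "fps_deriv f"] by (auto simp: f_def)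
  have rec: "of_nat (Suc k) * (b + of_nat k) * fps_nth f (Suc k) = (a + of_nat k) * fps_nth f k" for k
  proof -
    have "pochhammer b k \<noteq> 0"
      using assms by (rule pochhammer_nonzero)
    thus ?thesis
      using assms[of k]
      by (simp add: f_def kummer_fps_def pochhammer_Suc nonzero_divide_eq_eq nonzero_eq_divide_eq ac_simps
               del: of_nat_Suc)
  qed
  have "fps_X * fps_deriv (fps_deriv f) + (fps_const b - fps_X) * fps_deriv f = fps_const a * f"
  proof (rule fps_ext)
    fix k
    show "fps_nth (fps_X * fps_deriv (fps_deriv f) + (fps_const b - fps_X) * fps_deriv f) k
            = fps_nth (fps_const a * f) k"
      using rec[of k] by (cases k) (simp_all add: algebra_simps)
  qed
  hence "eval_fps (fps_X * fps_deriv (fps_deriv f) + (fps_const b - fps_X) * fps_deriv f) z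
           = eval_fps (fps_const a * f) z" by simp
  moreover have "fps_conv_radius (fps_X * fps_deriv (fps_deriv f)) = \<infinity>"
    "fps_conv_radius (fps_const b - fps_X) = \<infinity>" "fps_conv_radius ((fps_const b - fps_X) * fps_deriv f) = \<infinity>"
    using fps_conv_radius_mult[of fps_X "fps_deriv (fps_deriv f)"] fps_conv_radius_diff[of "fps_const b" fps_X]
       fps_conv_radius_mult[of "fps_const b - fps_X" "fps_deriv f"] r
    by auto
  ultimately have "z * eval_fps (fps_deriv (fps_deriv f)) z + (b - z) * eval_fps (fps_deriv f) z
           = a * eval_fps f z"
    by (simp add: eval_fps_add eval_fps_mult eval_fps_diff r)
  moreover have "eval_fps (fps_deriv f) = deriv (kummer_Phi a b)"
    by (auto simp: fun_eq_iff kummer_Phi_conv_eval_fps f_def eval_fps_deriv)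
  moreover have "eval_fps (fps_deriv (fps_deriv f)) = deriv (eval_fps (fps_deriv f))"
    by (auto simp: fun_eq_iff eval_fps_deriv r)
  ultimately show ?thesis by (simp add: f_def kummer_Phi_conv_eval_fps)
qed

text \<open>\<open>1 / (b)\<^sub>k = (1 + k / b) / (b + 1)\<^sub>k\<close>, and multiplying the \<open>k\<close>-th coefficient by \<open>k\<close> is the Euler
  operator. This expresses everything in \<open>comb_F\<close> by one Kummer function and its derivative.\<close>
lemma kummer_Phi_contiguous:
  assumes "\<And>k. b + of_nat k \<noteq> 0"
  shows "kummer_Phi a b z = kummer_Phi a (b + 1) z + z / b * deriv (kummer_Phi a (b + 1)) z"
proof -
  define f where "f = kummer_fps a (b + 1)"
  have r: "fps_conv_radius f = \<infinity>" "fps_conv_radius (fps_deriv f) = \<infinity>"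
    using fps_conv_radius_deriv[of f] by (auto simp: f_def)
  have "b \<noteq> 0" using assms[of 0] by simp
  have "kummer_fps a b = f + fps_const (1 / b) * (fps_X * fps_deriv f)"
  proof (rule fps_ext)
    fix k
    have p: "pochhammer b k * (b + of_nat k) = b * pochhammer (b + 1) k"
      by (metis pochhammer_Suc pochhammer_rec)
    have ne: "pochhammer b k \<noteq> 0" "pochhammer (b + 1) k \<noteq> 0"
      using assms assms[of "Suc _"] by (auto intro!: pochhammer_nonzero simp: add.assoc)
    have "1 / pochhammer b k = (b + of_nat k) / (b * pochhammer (b + 1) k)"
      using ne \<open>b \<noteq> 0\<close> assms[of k] unfolding p[symmetric] by simp
    also have "\<dots> = (1 + of_nat k / b) / pochhammer (b + 1) k"
      using ne \<open>b \<noteq> 0\<close> by (simp add: field_simps)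
    finally have "fps_nth (kummer_fps a b) k = (1 + of_nat k / b) * fps_nth f k"
      unfolding kummer_fps_def f_def fps_nth_Abs_fps
      by (metis (no_types, opaque_lifting) divide_divide_eq_left mult.commute times_divide_eq_left mult_1)
    thus "fps_nth (kummer_fps a b) k = fps_nth (f + fps_const (1 / b) * (fps_X * fps_deriv f)) k"
      by (cases k) (auto simp: algebra_simps add_divide_distrib)
  qed
  moreover have "fps_conv_radius (fps_X * fps_deriv f) = \<infinity>"
     "fps_conv_radius (fps_const (1/b) * (fps_X * fps_deriv f)) = \<infinity>"
    using fps_conv_radius_mult[of fps_X "fps_deriv f"] r
      fps_conv_radius_mult[of "fps_const (1/b)" "fps_X * fps_deriv f"] by auto
  ultimately have "eval_fps (kummer_fps a b) z = eval_fps f z + 1 / b * (z * eval_fps (fps_deriv f) z)"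
    using r by (simp add: eval_fps_add eval_fps_mult)
  thus ?thesis by (simp add: kummer_Phi_conv_eval_fps f_def eval_fps_deriv)
qed

lemma comb_F_holomorphic: "comb_F a b \<alpha> \<beta> holomorphic_on S"
  unfolding comb_F_def by (intro holomorphic_intros kummer_Phi_holomorphic)

lemma has_field_derivative_deriv_entire:
  assumes "f holomorphic_on UNIV"
  shows "(f has_field_derivative deriv f z) (at z)"
  using assms by (rule holomorphic_derivI) auto

text \<open>With \<open>\<Psi> = \<Phi>(a, b + 1, \<cdot>)\<close> and \<open>X = \<Psi>'\<close>, Kummer's equation turns \<open>F\<close>, \<open>F'\<close> and \<open>z F''\<close> into combinations
  of \<open>\<Psi>\<close> and \<open>X\<close> with polynomial coefficients; three vectors in a two-dimensional module satisfy a
  linear relation, and this is the one stated here. Up to the factor \<open>- b\<^sup>2\<close>, \<open>coeff_D\<close> is the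
  determinant of the coefficients of \<open>F\<close> and \<open>F'\<close>. The equation is kept free of denominators because
  the case of a zero of \<open>D\<close> at a root of \<open>F\<close> needs it there.\<close>
lemma comb_F_ode:
  assumes b: "\<And>k. b + of_nat k \<noteq> 0"
  shows "z * coeff_D a b \<alpha> \<beta> z * deriv (deriv (comb_F a b \<alpha> \<beta>)) z
         + ((b + 1 - z) * coeff_D a b \<alpha> \<beta> z - \<alpha> * (a * \<alpha> - \<alpha> * b - \<beta> * b) * z) * deriv (comb_F a b \<alpha> \<beta>) z
         = coeff_N a b \<alpha> \<beta> z * comb_F a b \<alpha> \<beta> z"
proof -
  define \<Psi> where "\<Psi> = kummer_Phi a (b + 1)"
  define X where "X = deriv \<Psi>"
  have "b \<noteq> 0" using b[of 0] by simp
  \<comment> \<open>With \<open>c\<close> in place of \<open>\<alpha>\<close> all coefficients become polynomials.\<close>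
  define c where "c = \<alpha> / b"
  have \<alpha>: "\<alpha> = c * b" using \<open>b \<noteq> 0\<close> by (simp add: c_def)
  have ode: "y * deriv X y = a * \<Psi> y - (b + 1 - y) * X y" for y
    using kummer_Phi_ode[of "b + 1" y a] b[of "Suc _"]
    by (simp add: X_def \<Psi>_def add.assoc algebra_simps)
  have d\<Psi>: "(\<Psi> has_field_derivative X y) (at y)" for y
    unfolding X_def \<Psi>_def by (intro has_field_derivative_deriv_entire kummer_Phi_holomorphic)
  have dX: "(X has_field_derivative deriv X y) (at y)" for y
    unfolding X_def \<Psi>_def
    by (intro has_field_derivative_deriv_entire holomorphic_deriv kummer_Phi_holomorphic) auto
  have F: "comb_F a b \<alpha> \<beta> = (\<lambda>y. (\<alpha> + \<beta>) * \<Psi> y + c * (y * X y))"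
    using \<open>b \<noteq> 0\<close> by (auto simp: fun_eq_iff comb_F_def kummer_Phi_contiguous[OF b] X_def \<Psi>_def c_def
                       field_simps)
  have F': "deriv (comb_F a b \<alpha> \<beta>) = (\<lambda>y. c * a * \<Psi> y + (\<beta> + c * y) * X y)"
  proof
    fix y
    have "(comb_F a b \<alpha> \<beta> has_field_derivative (\<alpha> + \<beta>) * X y + c * (X y + y * deriv X y)) (at y)"
      unfolding F by (auto intro!: derivative_eq_intros d\<Psi> dX)
    also have "(\<alpha> + \<beta>) * X y + c * (X y + y * deriv X y) = c * a * \<Psi> y + (\<beta> + c * y) * X y"
      unfolding ode \<alpha> by (simp add: algebra_simps)
    finally show "deriv (comb_F a b \<alpha> \<beta>) y = c * a * \<Psi> y + (\<beta> + c * y) * X y"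
      by (rule DERIV_imp_deriv)
  qed
  have "deriv (deriv (comb_F a b \<alpha> \<beta>)) z = c * a * X z + (c * X z + (\<beta> + c * z) * deriv X z)"
    unfolding F' by (rule DERIV_imp_deriv) (auto intro!: derivative_eq_intros d\<Psi> dX)
  hence F'': "z * deriv (deriv (comb_F a b \<alpha> \<beta>)) z
      = c * (a + 1) * (z * X z) + (\<beta> + c * z) * (a * \<Psi> z - (b + 1 - z) * X z)"
    unfolding ode[of z, symmetric] by (simp add: algebra_simps)
  have D: "coeff_D a b \<alpha> \<beta> z = b\<^sup>2 * (c * (c * a - c * b - \<beta>) * z - \<beta> * (c * b + \<beta>))"
    unfolding coeff_D_def \<alpha> by (simp add: algebra_simps power2_eq_square)
  have N: "coeff_N a b \<alpha> \<beta> z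
      = b\<^sup>2 * (a * (c * (c * a - c * b - \<beta>) * z - \<beta> * c * (b + 1) - \<beta>\<^sup>2))"
    unfolding coeff_N_def \<alpha> by (simp add: algebra_simps power2_eq_square)
  have d: "\<alpha> * (a * \<alpha> - \<alpha> * b - \<beta> * b) = b\<^sup>2 * (c * (c * a - c * b - \<beta>))"
    unfolding \<alpha> by (simp add: algebra_simps power2_eq_square)
  have poly: "D * (c * (a + 1) * (z * x) + (\<beta> + c * z) * (a * p - (b + 1 - z) * x))
      + ((b + 1 - z) * D - d * z) * (c * a * p + (\<beta> + c * z) * x)
      = N * ((c * b + \<beta>) * p + c * (z * x))"
    if "D = b\<^sup>2 * (c * (c * a - c * b - \<beta>) * z - \<beta> * (c * b + \<beta>))"
       "N = b\<^sup>2 * (a * (c * (c * a - c * b - \<beta>) * z - \<beta> * c * (b + 1) - \<beta>\<^sup>2))"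
       "d = b\<^sup>2 * (c * (c * a - c * b - \<beta>))" for D N d p x
    unfolding that by (simp only: algebra_simps power2_eq_square mult_1 mult_1_right)
  have F: "comb_F a b \<alpha> \<beta> z = (c * b + \<beta>) * \<Psi> z + c * (z * X z)"
    unfolding F by (simp add: \<alpha>)
  have "z * coeff_D a b \<alpha> \<beta> z * deriv (deriv (comb_F a b \<alpha> \<beta>)) z
     = coeff_D a b \<alpha> \<beta> z * (z * deriv (deriv (comb_F a b \<alpha> \<beta>)) z)" by simp
  thus ?thesis
    unfolding F'' F by (simp only: F' poly[OF D N d])
qed

lemma coeff_D_linear:
  "coeff_D a b \<alpha> \<beta> y = \<alpha> * (a * \<alpha> - \<alpha> * b - \<beta> * b) * y + coeff_D a b \<alpha> \<beta> 0"
  by (simp add: coeff_D_def algebra_simps power2_eq_square)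

lemma coeff_Q_has_field_derivative:
  assumes "y \<in> coeff_dom a b \<alpha> \<beta>"
  shows "(coeff_Q a b \<alpha> \<beta> has_field_derivative deriv (coeff_Q a b \<alpha> \<beta>) y) (at y)"
proof -
  define d1 d0 where "d1 = \<alpha> * (a * \<alpha> - \<alpha> * b - \<beta> * b)" and "d0 = coeff_D a b \<alpha> \<beta> 0"
  have D: "coeff_D a b \<alpha> \<beta> x = d1 * x + d0" for x
    unfolding d1_def d0_def by (rule coeff_D_linear)
  have y: "y \<noteq> 0" "d1 * y + d0 \<noteq> 0" using assms by (auto simp: coeff_dom_def D)
  have "coeff_Q a b \<alpha> \<beta> = (\<lambda>x. - 1 + (b + 1) / x - d1 / (d1 * x + d0))"
    by (simp add: fun_eq_iff coeff_Q_def D flip: d1_def)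
  moreover have "((\<lambda>x. - 1 + (b + 1) / x - d1 / (d1 * x + d0)) has_field_derivative
      - (b + 1) / y\<^sup>2 + d1 * d1 / (d1 * y + d0)\<^sup>2) (at y)"
    using y by (auto intro!: derivative_eq_intros simp: power2_eq_square field_simps)
  ultimately show ?thesis by (metis DERIV_imp_deriv)
qed

text \<open>Dividing the polynomial equation by \<open>y * D y\<close> brings it to the form \<open>F'' + Q F' + R F = 0\<close>.\<close>
lemma comb_F_normalized_ode:
  assumes b: "\<And>k. b + of_nat k \<noteq> 0" and y: "y \<in> coeff_dom a b \<alpha> \<beta>"
  shows "deriv (deriv (comb_F a b \<alpha> \<beta>)) y =
    - coeff_Q a b \<alpha> \<beta> y * deriv (comb_F a b \<alpha> \<beta>) y - coeff_R a b \<alpha> \<beta> y * comb_F a b \<alpha> \<beta> y"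
proof -
  define F where "F = comb_F a b \<alpha> \<beta>"
  define Dy where "Dy = coeff_D a b \<alpha> \<beta> y"
  define d1 where "d1 = \<alpha> * (a * \<alpha> - \<alpha> * b - \<beta> * b)"
  define Qy Ry where "Qy = coeff_Q a b \<alpha> \<beta> y" and "Ry = coeff_R a b \<alpha> \<beta> y"
  have nz: "y \<noteq> 0" "Dy \<noteq> 0" using y by (auto simp: coeff_dom_def Dy_def)
  have ode: "y * Dy * deriv (deriv F) y + ((b + 1 - y) * Dy - d1 * y) * deriv F y
      = coeff_N a b \<alpha> \<beta> y * F y"
    using comb_F_ode[OF b] unfolding F_def Dy_def d1_def .
  have R: "Ry * (y * Dy) = - coeff_N a b \<alpha> \<beta> y"
    using nz by (simp add: Ry_def coeff_R_def Dy_def)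
  have Q: "Qy * (y * Dy) = (b + 1 - y) * Dy - d1 * y"
  proof -
    have "Qy = - 1 + (b + 1) / y - d1 / Dy"
      by (simp only: Qy_def coeff_Q_def d1_def Dy_def)
    thus ?thesis using nz by (simp add: field_simps)
  qed
  have "y * Dy * (deriv (deriv F) y + Qy * deriv F y + Ry * F y)
     = y * Dy * deriv (deriv F) y + (Qy * (y * Dy)) * deriv F y + (Ry * (y * Dy)) * F y"
    by (simp only: algebra_simps)
  also have "\<dots> = 0" unfolding R Q using ode by simp
  finally have "deriv (deriv F) y + Qy * deriv F y + Ry * F y = 0"
    using nz by (metis mult_eq_0_iff)
  hence "deriv (deriv F) y = - Qy * deriv F y - Ry * F y" by algebra
  thus ?thesis unfolding F_def Qy_def Ry_def .
qed

section \<open>The energy argument\<close>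

lemma has_real_derivative_norm_complex:
  fixes f :: "real \<Rightarrow> complex"
  assumes "(f has_vector_derivative f') (at t)" "f t \<noteq> 0"
  shows "((\<lambda>t. norm (f t)) has_real_derivative norm (f t) * Re (f' / f t)) (at t)"
proof -
  have "((\<lambda>t. norm (f t)) has_derivative (\<lambda>x. inner (x *\<^sub>R f') (sgn (f t)))) (at t)"
    using has_derivative_compose[OF assms(1)[unfolded has_vector_derivative_def] has_derivative_norm[OF assms(2)]] .
  moreover have "inner f' (sgn (f t)) = norm (f t) * Re (f' / f t)"
  proof -
    have "inner f' (f t) = Re (f' * cnj (f t))" by (simp add: inner_complex_def)
    also have "f' * cnj (f t) = f' / f t * of_real ((norm (f t))\<^sup>2)"
      using assms(2) by (simp add: complex_norm_square del: of_real_power)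
    also have "Re (f' / f t * of_real ((norm (f t))\<^sup>2)) = (norm (f t))\<^sup>2 * Re (f' / f t)"
      by (simp only: times_complex.sel Re_complex_of_real Im_complex_of_real) simp
    finally have "inner f' (f t) = (norm (f t))\<^sup>2 * Re (f' / f t)" .
    thus ?thesis using assms(2) by (simp add: sgn_div_norm power2_eq_square)
  qed
  ultimately show ?thesis
    by (simp add: has_field_derivative_def mult_commute_abs)
qed

lemma nonincreasing_tendsto_zero_imp_zero:
  fixes P :: "real \<Rightarrow> real"
  assumes d: "\<And>t. 0 < t \<Longrightarrow> t < 1 \<Longrightarrow> (P has_real_derivative P' t) (at t)"
    and le: "\<And>t. 0 < t \<Longrightarrow> t < 1 \<Longrightarrow> P' t \<le> 0"
    and lim0: "(P \<longlongrightarrow> 0) (at_right 0)" and lim1: "(P \<longlongrightarrow> 0) (at_left 1)"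
    and t: "0 < t" "t < 1"
  shows "P t = 0"
proof (rule antisym)
  have mono: "P y \<le> P x" if "0 < x" "x \<le> y" "y < 1" for x y
    by (rule DERIV_nonpos_imp_nonincreasing[OF that(2)])
       (use that d le in \<open>metis dual_order.strict_trans1 dual_order.strict_trans2\<close>)
  have "eventually (\<lambda>x. x \<in> {0<..<t}) (at_right 0)"
    using t by (intro eventually_at_right_real) auto
  hence "eventually (\<lambda>x. P t \<le> P x) (at_right 0)"
    by eventually_elim (use t in \<open>auto intro: mono\<close>)
  thus "P t \<le> 0" by (intro tendsto_lowerbound[OF lim0]) auto
  have "eventually (\<lambda>x. x \<in> {t<..<1}) (at_left 1)"
    using t by (intro eventually_at_left_real) auto
  hence "eventually (\<lambda>x. P x \<le> P t) (at_left 1)"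
    by eventually_elim (use t in \<open>auto intro: mono\<close>)
  thus "0 \<le> P t" by (intro tendsto_upperbound[OF lim1]) auto
qed

text \<open>Here \<open>w\<close> plays the role of \<open>|S|\<^sup>2\<close>, so that \<open>P = Re (u cnj v) w\<close> is the real part of the conjugate of
  \<open>\<phi>\<close> times \<open>\<phi>' / z\<close> for a function \<open>\<phi> = v S\<close> with \<open>\<phi>'' + z\<^sup>2 g \<phi> = 0\<close>. The terms with \<open>q\<close> cancel in
  the derivative of \<open>P\<close>, which leaves \<open>P' = (Re z |u|\<^sup>2 - Re (z g) |v|\<^sup>2) w \<le> 0\<close>. The limits at both
  ends then force \<open>P = 0\<close>, so \<open>u = 0\<close>; this makes \<open>|v|\<^sup>2 w\<close> constant, and its limit at \<open>0\<close> is zero.\<close>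
lemma energy_argument:
  fixes u v q g :: "real \<Rightarrow> complex" and w :: "real \<Rightarrow> real" and z :: complex
  assumes v': "\<And>t. 0 < t \<Longrightarrow> t < 1 \<Longrightarrow>
                (v has_vector_derivative z * (u t - q t / 2 * v t)) (at t)"
    and u': "\<And>t. 0 < t \<Longrightarrow> t < 1 \<Longrightarrow>
                (u has_vector_derivative - z * (g t * v t + q t / 2 * u t)) (at t)"
    and w': "\<And>t. 0 < t \<Longrightarrow> t < 1 \<Longrightarrow> (w has_real_derivative Re (z * q t) * w t) (at t)"
    and wpos: "\<And>t. 0 < t \<Longrightarrow> t < 1 \<Longrightarrow> w t > 0"
    and g: "\<And>t. 0 < t \<Longrightarrow> t < 1 \<Longrightarrow> Re (z * g t) \<ge> 0"
    and z: "Re z < 0"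
    and lim0: "((\<lambda>t. Re (u t * cnj (v t)) * w t) \<longlongrightarrow> 0) (at_right 0)"
    and lim1: "((\<lambda>t. Re (u t * cnj (v t)) * w t) \<longlongrightarrow> 0) (at_left 1)"
    and limv: "((\<lambda>t. (norm (v t))\<^sup>2 * w t) \<longlongrightarrow> 0) (at_right 0)"
    and t: "0 < t" "t < 1"
  shows "v t = 0"
proof -
  define P where "P t = Re (u t * cnj (v t)) * w t" for t
  define P' where "P' t = (Re z * (norm (u t))\<^sup>2 - Re (z * g t) * (norm (v t))\<^sup>2) * w t" for t
  have dP: "(P has_real_derivative P' t) (at t)" if t: "0 < t" "t < 1" for t
  proof -
    have half: "(x + cnj x) / 2 = of_real (Re x)" for x
      unfolding complex_add_cnj by simp
    have "u t * cnj (z * (u t - q t / 2 * v t)) + - z * (g t * v t + q t / 2 * u t) * cnj (v t)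
       = cnj z * (u t * cnj (u t)) - z * g t * (v t * cnj (v t))
         - (z * q t + cnj (z * q t)) / 2 * (u t * cnj (v t))"
      by (simp add: algebra_simps add_divide_distrib)
    also have "Re \<dots> = Re z * (norm (u t))\<^sup>2 - Re (z * g t) * (norm (v t))\<^sup>2
         - Re (z * q t) * Re (u t * cnj (v t))"
      unfolding half complex_norm_square[symmetric]
      by (simp only: minus_complex.sel times_complex.sel(1)[of _ "of_real _"]
            times_complex.sel(1)[of "of_real _"] Re_complex_of_real Im_complex_of_real cnj.sel)
    finally have eq: "Re (u t * cnj (z * (u t - q t / 2 * v t))
           + - z * (g t * v t + q t / 2 * u t) * cnj (v t))
       = Re z * (norm (u t))\<^sup>2 - Re (z * g t) * (norm (v t))\<^sup>2
         - Re (z * q t) * Re (u t * cnj (v t))" .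
    have "(P has_real_derivative
            Re (u t * cnj (z * (u t - q t / 2 * v t)) + - z * (g t * v t + q t / 2 * u t) * cnj (v t)) * w t
            + Re (z * q t) * w t * Re (u t * cnj (v t))) (at t)"
      unfolding P_def
      by (intro DERIV_mult has_field_derivative_Re has_vector_derivative_mult
            has_vector_derivative_cnj u' v' w' t)
    also have "Re (u t * cnj (z * (u t - q t / 2 * v t)) + - z * (g t * v t + q t / 2 * u t) * cnj (v t)) * w t
            + Re (z * q t) * w t * Re (u t * cnj (v t)) = P' t"
      unfolding eq P'_def by (simp only: algebra_simps)
    finally show ?thesis .
  qed
  have P'_le: "P' t \<le> 0" if t: "0 < t" "t < 1" for t
    unfolding P'_def using wpos[OF t] g[OF t] z
    by (intro mult_nonpos_nonneg) (auto simp: mult_nonpos_nonneg intro!: order.trans[OF mult_nonpos_nonneg mult_nonneg_nonneg])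
  have P0: "P t = 0" if t: "0 < t" "t < 1" for t
    using nonincreasing_tendsto_zero_imp_zero[OF dP P'_le _ _ t] lim0 lim1
    unfolding P_def[symmetric] by blast
  have u0: "u t = 0" if t: "0 < t" "t < 1" for t
  proof (rule ccontr)
    assume "u t \<noteq> 0"
    hence "P' t < 0" 
      unfolding P'_def using wpos[OF t] g[OF t] z
      by (intro mult_neg_pos) (auto intro!: less_le_trans[OF mult_neg_pos mult_nonneg_nonneg])
    moreover have "P' t = 0"
    proof (rule DERIV_unique[OF dP[OF t]])
      have "((\<lambda>_. 0) has_real_derivative 0) (at t)" by simp
      thus "(P has_real_derivative 0) (at t)"
        by (rule has_field_derivative_transform_within_open[of _ _ _ "{0<..<1}"]) (use t P0 in auto)
    qed
    ultimately show False by simp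
  qed
  define K where "K t = (norm (v t))\<^sup>2 * w t" for t
  have dK: "(K has_real_derivative 0) (at t)" if t: "0 < t" "t < 1" for t
  proof -
    have K: "K = (\<lambda>t. Re (v t * cnj (v t)) * w t)"
      by (auto simp: K_def fun_eq_iff cmod_power2 simp flip: power2_eq_square)
    have v0: "z * (u t - q t / 2 * v t) = - (z * q t / 2) * v t" using u0[OF t] by simp
    have "(K has_real_derivative
            Re (v t * cnj (- (z * q t / 2) * v t) + - (z * q t / 2) * v t * cnj (v t)) * w t
            + Re (z * q t) * w t * Re (v t * cnj (v t))) (at t)"
      unfolding K v0[symmetric]
      by (intro DERIV_mult has_field_derivative_Re has_vector_derivative_mult
            has_vector_derivative_cnj v' w' t)
    also have "v t * cnj (- (z * q t / 2) * v t) + - (z * q t / 2) * v t * cnj (v t)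
        = - ((z * q t + cnj (z * q t)) / 2 * (v t * cnj (v t)))"
      by (simp add: algebra_simps add_divide_distrib)
    also have "Re (- ((z * q t + cnj (z * q t)) / 2 * (v t * cnj (v t)))) * w t
        + Re (z * q t) * w t * Re (v t * cnj (v t)) = 0"
      unfolding complex_add_cnj complex_norm_square[symmetric]
      by (simp add: field_simps flip: of_real_power)
    finally show ?thesis .
  qed
  have const: "K x = K t" if "x \<in> {0<..<t}" for x
    by (rule DERIV_isconst3[of 0 1]) (use that t dK in auto)
  have "eventually (\<lambda>x. x \<in> {0<..<t}) (at_right 0)"
    using t by (intro eventually_at_right_real) auto
  hence "eventually (\<lambda>x. K x = K t) (at_right 0)" by eventually_elim (rule const)
  moreover have "(K \<longlongrightarrow> 0) (at_right 0)" using limv unfolding K_def[abs_def] .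
  ultimately have "((\<lambda>_. K t) \<longlongrightarrow> 0) (at_right (0::real))" by (rule Lim_transform_eventually[rotated])
  hence "K t = 0" by (simp add: tendsto_const_iff)
  thus ?thesis using wpos[OF t] by (simp add: K_def)
qed

lemma tendsto_linear_along_ray:
  "((\<lambda>t::real. of_real t * z) \<longlongrightarrow> of_real t0 * (z::complex)) (at t0 within S)"
  by (intro tendsto_intros)

lemma entire_tendsto_along_ray:
  assumes "f holomorphic_on UNIV"
  shows "((\<lambda>t::real. f (of_real t * z)) \<longlongrightarrow> f (of_real t0 * z)) (at t0 within S)"
proof -
  have "isCont f (of_real t0 * z)"
    using assms by (meson UNIV_I continuous_on_eq_continuous_at holomorphic_on_imp_continuous_on open_UNIV)
  thus ?thesis by (rule isCont_tendsto_compose) (rule tendsto_linear_along_ray)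
qed

lemma has_vector_derivative_along_ray:
  fixes f :: "complex \<Rightarrow> complex" and t :: real
  assumes "(f has_field_derivative f') (at (of_real t * z))"
  shows "((\<lambda>t. f (of_real t * z)) has_vector_derivative z * f') (at t)"
proof -
  have "((\<lambda>y. f (y * z)) has_field_derivative f' * z) (at (of_real t))"
    by (rule DERIV_chain2[where f = f and g = "\<lambda>y. y * z", OF assms])
       (auto intro!: derivative_eq_intros)
  thus ?thesis by (subst mult.commute, intro has_vector_derivative_real_field)
qed

text \<open>The energy argument applied along the segment from \<open>0\<close> to \<open>z\<close>. What has to be checked is the decay
  of the boundary terms. At \<open>0\<close> it comes from the factor \<open>t\<^bsup>b+1\<^esup>\<close> of the weight: \<open>u\<close> has at most a
  simple pole and \<open>1 / D\<close> at most another one (if \<open>D 0 = 0\<close>), so \<open>b > 1\<close> suffices. At \<open>1\<close> it comes from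
  \<open>F z = 0\<close>; the hypotheses allow \<open>D z = 0\<close>, but then the polynomial differential equation yields
  \<open>F' z = 0\<close>, so that \<open>F / D\<close> still tends to zero.\<close>
lemma comb_F_no_left_root:
  fixes a \<alpha> \<beta> z w0 :: complex and b :: real
  assumes b: "b > 1"
    and nz: "comb_F a b \<alpha> \<beta> w0 \<noteq> 0"
    and z: "Re z < 0"
    and dom: "\<And>t::real. 0 < t \<Longrightarrow> t < 1 \<Longrightarrow> of_real t * z \<in> coeff_dom a b \<alpha> \<beta>"
    and sgn: "\<And>t::real. 0 < t \<Longrightarrow> t < 1 \<Longrightarrow> Re (z * coeff_G a b \<alpha> \<beta> (of_real t * z)) \<ge> 0"
  shows "comb_F a b \<alpha> \<beta> z \<noteq> 0"
proof
  assume root: "comb_F a b \<alpha> \<beta> z = 0"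
  define F where "F = comb_F a b \<alpha> \<beta>"
  define D where "D = coeff_D a b \<alpha> \<beta>"
  define Q where "Q = coeff_Q a b \<alpha> \<beta>"
  define d1 where "d1 = \<alpha> * (a * \<alpha> - \<alpha> * of_real b - \<beta> * of_real b)"
  define d0 where "d0 = D 0"
  have b_nat: "complex_of_real b + of_nat k \<noteq> 0" for k
  proof -
    have "b + real k \<noteq> 0" using b by linarith
    thus ?thesis by (metis of_real_add of_real_eq_0_iff of_real_of_nat_eq)
  qed
  have D: "D y = d1 * y + d0" for y
    unfolding D_def d0_def d1_def by (rule coeff_D_linear)
  have dF: "(F has_field_derivative deriv F y) (at y)" for y
    unfolding F_def by (intro has_field_derivative_deriv_entire comb_F_holomorphic)
  have hF: "F holomorphic_on UNIV" "deriv F holomorphic_on UNIV"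
    unfolding F_def by (auto intro!: comb_F_holomorphic holomorphic_deriv)
  have ddF: "(deriv F has_field_derivative deriv (deriv F) y) (at y)" for y
    by (intro has_field_derivative_deriv_entire hF)
  have ode: "y * D y * deriv (deriv F) y + ((of_real b + 1 - y) * D y - d1 * y) * deriv F y
      = coeff_N a b \<alpha> \<beta> y * F y" for y :: complex
    using comb_F_ode[OF b_nat] unfolding F_def D_def d1_def .
  have z0: "z \<noteq> 0" using z by auto
  have D_nz: "D (of_real t * z) \<noteq> 0" if "0 < t" "t < 1" for t
    using dom[OF that] by (simp add: coeff_dom_def D_def)
  have d_nz: "d1 \<noteq> 0 \<or> d0 \<noteq> 0"
    using D_nz[of "1/2"] by (auto simp: D)
  have Q: "Q y = - 1 + (of_real b + 1) / y - d1 / D y" for y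
    by (simp add: Q_def coeff_Q_def d1_def D_def)
  have in_dom: "y \<in> coeff_dom a b \<alpha> \<beta>" if "y \<noteq> 0" "D y \<noteq> 0" for y
    using that by (simp add: coeff_dom_def D_def)
  have dQ: "(Q has_field_derivative deriv Q y) (at y)" if "y \<noteq> 0" "D y \<noteq> 0" for y
    unfolding Q_def by (rule coeff_Q_has_field_derivative[OF in_dom[OF that]])
  have F'': "deriv (deriv F) y = - Q y * deriv F y - coeff_R a b \<alpha> \<beta> y * F y"
    if "y \<noteq> 0" "D y \<noteq> 0" for y
    unfolding F_def Q_def by (rule comb_F_normalized_ode[OF b_nat in_dom[OF that]])
  define v where "v t = F (of_real t * z)" for t :: real
  define u where "u t = deriv F (of_real t * z) + Q (of_real t * z) / 2 * F (of_real t * z)" for t :: real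
  define w where "w t = exp (- (t * Re z)) * (t powr (b + 1) / norm (D (of_real t * z)))" for t :: real
  have v0: "v t = 0" if t: "0 < t" "t < 1" for t
  proof (rule energy_argument[where v = v and u = u and w = w and z = z
        and q = "\<lambda>t. Q (of_real t * z)" and g = "\<lambda>t. coeff_G a b \<alpha> \<beta> (of_real t * z)"])
    fix t :: real assume t: "0 < t" "t < 1"
    define y where "y = of_real t * z"
    have y: "y \<noteq> 0" "D y \<noteq> 0" using t z0 D_nz by (auto simp: y_def)
    show "(v has_vector_derivative z * (u t - Q (of_real t * z) / 2 * v t)) (at t)"
      unfolding v_def u_def by simp (rule has_vector_derivative_along_ray[OF dF])
    have "((\<lambda>y. deriv F y + Q y / 2 * F y) has_field_derivative
             deriv (deriv F) y + (deriv Q y / 2 * F y + deriv F y * (Q y / 2))) (at y)"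
      by (intro DERIV_add DERIV_mult dF ddF DERIV_cdivide dQ y)
    also have "deriv (deriv F) y + (deriv Q y / 2 * F y + deriv F y * (Q y / 2))
       = - (coeff_G a b \<alpha> \<beta> y * F y + Q y / 2 * (deriv F y + Q y / 2 * F y))"
      unfolding F''[OF y] coeff_G_def Q_def[symmetric]
      by (simp add: field_simps power2_eq_square)
    finally have "(u has_vector_derivative
        z * - (coeff_G a b \<alpha> \<beta> y * F y + Q y / 2 * (deriv F y + Q y / 2 * F y))) (at t)"
      unfolding u_def[abs_def] y_def by (rule has_vector_derivative_along_ray)
    thus "(u has_vector_derivative - z * (coeff_G a b \<alpha> \<beta> (of_real t * z) * v t
              + Q (of_real t * z) / 2 * u t)) (at t)"
      by (simp only: u_def v_def y_def mult_minus_left mult_minus_right)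
    show "0 < w t" using t y by (simp add: w_def y_def)
    show "0 \<le> Re (z * coeff_G a b \<alpha> \<beta> (of_real t * z))" using sgn[OF t] .
    have nD: "((\<lambda>t. norm (D (of_real t * z))) has_real_derivative
        norm (D y) * Re (z * d1 / D y)) (at t)"
      unfolding y_def
    proof (rule has_real_derivative_norm_complex)
      show "((\<lambda>t. D (of_real t * z)) has_vector_derivative z * d1) (at t)"
        by (rule has_vector_derivative_along_ray) (auto simp: D[abs_def] intro!: derivative_eq_intros)
    qed (use y in \<open>auto simp: y_def\<close>)
    have "(w has_real_derivative
             exp (- (t * Re z)) * (- Re z) * (t powr (b + 1) / norm (D y)) +
             exp (- (t * Re z)) * (((b + 1) * t powr b) * norm (D y)
               - t powr (b + 1) * (norm (D y) * Re (z * d1 / D y))) / (norm (D y) * norm (D y))) (at t)"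
      unfolding w_def[abs_def]
      using t y(2) unfolding y_def
      by (auto intro!: derivative_eq_intros nD[unfolded y_def] simp: y_def) (simp add: field_simps)
    moreover have "t powr b = t powr (b + 1) / t" using t by (simp add: powr_add)
    moreover have "z * ((of_real b + 1) / y) = of_real ((b + 1) / t)"
      using t z0 by (simp add: y_def)
    hence "Re (z * Q y) = - Re z + (b + 1) / t - Re (z * d1 / D y)"
      unfolding Q by (simp only: ring_distribs times_divide_eq_right[of z d1, symmetric]) simp
    moreover have "e * (- Re z) * (p / N) + e * (((b + 1) * (p / t)) * N - p * (N * r)) / (N * N)
        = (- Re z + (b + 1) / t - r) * (e * (p / N))" if "N \<noteq> 0" for e p N r :: real
      using that t by (simp add: field_simps)
    moreover have "norm (D y) \<noteq> 0" using y by simp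
    ultimately show "(w has_real_derivative Re (z * Q (of_real t * z)) * w t) (at t)"
      by (simp only: w_def y_def[symmetric] not_False_eq_True)
  next
    \<comment> \<open>The limit \<open>L\<close> is \<open>0\<close> if \<open>D 0 \<noteq> 0\<close>, and \<open>1 / (d1 z)\<close> if \<open>D\<close> has its zero at the origin.\<close>
    have tD: "\<exists>L. ((\<lambda>t. of_real t / D (of_real t * z)) \<longlongrightarrow> L) (at_right 0)"
    proof (cases "d0 = 0")
      case True
      with d_nz have "d1 \<noteq> 0" by simp
      have "eventually (\<lambda>t::real. 1 / (d1 * z) = of_real t / D (of_real t * z)) (at_right 0)"
        using eventually_at_right_less[of "0::real"]
        by eventually_elim (use \<open>d1 \<noteq> 0\<close> z0 True in \<open>simp add: D\<close>)
      thus ?thesis by (intro exI) (rule Lim_transform_eventually[OF tendsto_const])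
    next
      case False
      have "((\<lambda>t. of_real t / (d1 * (of_real t * z) + d0)) \<longlongrightarrow> of_real 0 / (d1 * (of_real 0 * z) + d0)) (at_right 0)"
        by (intro tendsto_intros) (use False in auto)
      thus ?thesis unfolding D by blast
    qed
    then obtain L where L: "((\<lambda>t. of_real t / D (of_real t * z)) \<longlongrightarrow> L) (at_right 0)" by blast
    have limF: "(v \<longlongrightarrow> F (of_real 0 * z)) (at_right 0)"
       "((\<lambda>t. deriv F (of_real t * z)) \<longlongrightarrow> deriv F (of_real 0 * z)) (at_right 0)"
      unfolding v_def[abs_def] using hF by (auto intro: entire_tendsto_along_ray simp del: of_real_0)
    have pw: "((\<lambda>t::real. t powr c) \<longlongrightarrow> 0) (at_right 0)" if "c > 0" for c :: real
      using that by (intro tendsto_zero_powrI[OF tendsto_ident_at tendsto_const]) 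
         (auto simp: eventually_at_right_less intro: eventually_mono[OF eventually_at_right_less])
    have pos: "eventually (\<lambda>t::real. t > 0) (at_right 0)" by (rule eventually_at_right_less)
    show "((\<lambda>t. (norm (v t))\<^sup>2 * w t) \<longlongrightarrow> 0) (at_right 0)"
    proof (rule Lim_transform_eventually)
      have "((\<lambda>t. (norm (v t))\<^sup>2 * (exp (- (t * Re z)) * (t powr b * norm (of_real t / D (of_real t * z)))))
         \<longlongrightarrow> (norm (F (of_real 0 * z)))\<^sup>2 * (exp (- (0 * Re z)) * (0 * norm L))) (at_right 0)"
        using b by (intro tendsto_intros limF L pw) auto
      thus "((\<lambda>t. (norm (v t))\<^sup>2 * (exp (- (t * Re z)) * (t powr b * norm (of_real t / D (of_real t * z)))))
         \<longlongrightarrow> 0) (at_right 0)" by simp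
      show "eventually (\<lambda>t. (norm (v t))\<^sup>2 * (exp (- (t * Re z)) * (t powr b * norm (of_real t / D (of_real t * z))))
          = (norm (v t))\<^sup>2 * w t) (at_right 0)"
        using pos by eventually_elim (simp add: w_def powr_add norm_divide)
    qed
    show "((\<lambda>t. Re (u t * cnj (v t)) * w t) \<longlongrightarrow> 0) (at_right 0)"
    proof (rule Lim_transform_eventually)
      \<comment> \<open>\<open>?tu t\<close> is \<open>t * u t\<close> with the poles at \<open>0\<close> cleared; the weight splits as
        \<open>t\<^bsup>b-1\<^esup> * t * (t / |D|)\<close>, and the middle factor is the one absorbed into \<open>?tu\<close>.\<close>
      let ?tu = "\<lambda>t. of_real t * deriv F (of_real t * z)
        + (- of_real t + (of_real b + 1) / z - d1 * (of_real t / D (of_real t * z))) / 2 * v t"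
      let ?f = "\<lambda>t. Re (?tu t * cnj (v t)) * (exp (- (t * Re z))
               * (t powr (b - 1) * norm (of_real t / D (of_real t * z))))"
      have "(?f \<longlongrightarrow> Re ((of_real 0 * deriv F (of_real 0 * z)
           + (- of_real 0 + (of_real b + 1) / z - d1 * L) / 2 * F (of_real 0 * z)) * cnj (F (of_real 0 * z)))
            * (exp (- (0 * Re z)) * (0 * norm L))) (at_right 0)"
        using b z0 by (intro tendsto_intros limF L pw) auto
      thus "(?f \<longlongrightarrow> 0) (at_right 0)" by simp
      show "eventually (\<lambda>t. ?f t = Re (u t * cnj (v t)) * w t) (at_right 0)"
        using pos
      proof eventually_elim
        fix t :: real assume t: "0 < t"
        have "?tu t = of_real t * u t"
          using t z0 by (simp add: u_def v_def Q field_simps)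
        moreover have "Re (of_real t * x) = t * Re x" for x by simp
        ultimately have "Re (?tu t * cnj (v t)) = t * Re (u t * cnj (v t))"
          by (simp only: mult.assoc)
        moreover have "t powr (b + 1) = t * (t powr (b - 1) * t)"
          using t by (simp add: powr_add powr_diff)
        ultimately show "?f t = Re (u t * cnj (v t)) * w t"
          using t by (simp add: w_def norm_divide)
      qed
    qed
    have lt1: "eventually (\<lambda>t::real. t < 1) (at_left 1)" by (simp add: eventually_at_filter)
    have limF: "(v \<longlongrightarrow> F (of_real 1 * z)) (at_left 1)"
       "((\<lambda>t. deriv F (of_real t * z)) \<longlongrightarrow> deriv F (of_real 1 * z)) (at_left 1)"
      unfolding v_def[abs_def] using hF by (auto intro: entire_tendsto_along_ray simp del: of_real_1)
    have vD: "((\<lambda>t. v t / D (of_real t * z)) \<longlongrightarrow> 0) (at_left 1)"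
    proof (cases "D z = 0")
      case False
      have "((\<lambda>t. v t / (d1 * (of_real t * z) + d0)) \<longlongrightarrow> F (of_real 1 * z) / (d1 * (of_real 1 * z) + d0)) (at_left 1)"
        by (intro tendsto_intros limF) (use False in \<open>auto simp: D\<close>)
      thus ?thesis using root by (simp add: D F_def)
    next
      case True
      hence d0: "d0 = - (d1 * z)" by (simp add: D add_eq_0_iff)
      hence "d1 \<noteq> 0" using d_nz by auto
      \<comment> \<open>At \<open>z\<close> the equation reduces to \<open>- d1 z F' z = 0\<close>.\<close>
      have F'z: "deriv F z = 0"
        using ode[of z] True root \<open>d1 \<noteq> 0\<close> z0 by (simp add: F_def)
      have "((\<lambda>y. (F y - F z) / (y - z)) \<longlongrightarrow> 0) (at z)"
        using dF[of z] F'z by (simp add: has_field_derivative_iff)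
      moreover have "filterlim (\<lambda>t. of_real t * z) (at z) (at_left (1::real))"
      proof (rule filterlim_atI)
        show "((\<lambda>t. of_real t * z) \<longlongrightarrow> z) (at_left (1::real))"
          using tendsto_linear_along_ray[of z 1] by simp
        show "eventually (\<lambda>t. of_real t * z \<noteq> z) (at_left (1::real))"
          using lt1 by eventually_elim (use z0 in auto)
      qed
      ultimately have "((\<lambda>t. (F (of_real t * z) - F z) / (of_real t * z - z)) \<longlongrightarrow> 0) (at_left (1::real))"
        by (rule filterlim_compose)
      hence "((\<lambda>t. 1 / d1 * ((F (of_real t * z) - F z) / (of_real t * z - z))) \<longlongrightarrow> 0) (at_left (1::real))"
        by (rule tendsto_mult_right_zero)
      moreover have "1 / d1 * ((F (of_real t * z) - F z) / (of_real t * z - z)) = v t / D (of_real t * z)" for t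
        using root \<open>d1 \<noteq> 0\<close> by (simp add: v_def D d0 F_def flip: right_diff_distrib)
      ultimately show ?thesis by simp
    qed
    show "((\<lambda>t. Re (u t * cnj (v t)) * w t) \<longlongrightarrow> 0) (at_left 1)"
    proof (rule Lim_transform_eventually)
      let ?u = "\<lambda>t. deriv F (of_real t * z)
        + ((- 1 + (of_real b + 1) / (of_real t * z)) * v t - d1 * (v t / D (of_real t * z))) / 2"
      let ?f = "\<lambda>t. Re (?u t * (cnj (v t) / of_real (norm (D (of_real t * z))))) *
                  (exp (- (t * Re z)) * t powr (b + 1))"
      \<comment> \<open>The factor \<open>1 / |D|\<close> of the weight is paired with \<open>cnj v\<close>.\<close>
      have vD': "((\<lambda>t. cnj (v t) / of_real (norm (D (of_real t * z)))) \<longlongrightarrow> 0) (at_left 1)"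
        by (rule tendsto_norm_zero_cancel) (use tendsto_norm_zero[OF vD] in \<open>simp add: norm_divide\<close>)
      have k: "((\<lambda>t. - 1 + (of_real b + 1) / (of_real t * z)) \<longlongrightarrow> - 1 + (of_real b + 1) / (of_real 1 * z)) (at_left 1)"
        by (intro tendsto_intros) (use z0 in auto)
      have "((\<lambda>t. exp (- (t * Re z)) * t powr (b + 1)) \<longlongrightarrow> exp (- (1 * Re z)) * 1 powr (b + 1)) (at_left 1)"
        by (intro tendsto_intros) auto
      from tendsto_mult[OF tendsto_Re[OF tendsto_mult[OF tendsto_add[OF limF(2)
             tendsto_divide[OF tendsto_diff[OF tendsto_mult[OF k limF(1)]
             tendsto_mult_left[OF vD]] tendsto_const[of 2]]] vD']] this]
      show "(?f \<longlongrightarrow> 0) (at_left 1)" by simp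
      show "eventually (\<lambda>t. ?f t = Re (u t * cnj (v t)) * w t) (at_left 1)"
      proof (rule always_eventually, rule allI)
        fix t :: real
        have "?u t = u t" by (simp add: u_def v_def Q algebra_simps add_divide_distrib diff_divide_distrib)
        thus "?f t = Re (u t * cnj (v t)) * w t" by (simp add: w_def)
      qed
    qed
  qed (use z t in auto)
  have "F w0 = 0"
  proof (rule analytic_continuation[of F UNIV "{y. F y = 0}" 0 w0])
    show "0 islimpt {y. F y = 0}"
      unfolding islimpt_approachable
    proof (intro allI impI)
      fix e :: real assume "e > 0"
      define t where "t = min (1/2) (e / (2 * norm z))"
      have t: "0 < t" "t < 1" "t * norm z < e"
        using \<open>e > 0\<close> z0 by (auto simp: t_def min_def field_simps)
      show "\<exists>y\<in>{y. F y = 0}. y \<noteq> 0 \<and> dist y 0 < e"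
        using v0[of t] t z0 by (intro bexI[of _ "of_real t * z"]) (auto simp: v_def norm_mult)
    qed
  qed (use hF in auto)
  thus False using nz by (simp add: F_def)
qed

section \<open>The integral representation\<close>

lemma has_integral_beta_power:
  "((\<lambda>t::real. t ^ p * (1 - t) ^ q) has_integral fact p * fact q / fact (p + q + 1)) {0..1}"
proof -
  have "((\<lambda>t. t powr (real (p + 1) - 1) * (1 - t) powr (real (q + 1) - 1)) has_integral
          Beta (real (p + 1)) (real (q + 1))) {0<..<1}"
    using has_integral_Beta_real[of "real (p + 1)" "real (q + 1)"] by (simp add: has_integral_Icc_iff_Ioo)
  also have "Beta (real (p + 1)) (real (q + 1)) = fact p * fact q / fact (p + q + 1)"
    using Gamma_fact[of p, where 'a = real] Gamma_fact[of q, where 'a = real]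
      Gamma_fact[of "p + q + 1", where 'a = real]
    by (simp add: Beta_def algebra_simps)
  finally have "((\<lambda>t::real. t ^ p * (1 - t) ^ q) has_integral fact p * fact q / fact (p + q + 1)) {0<..<1}"
    by (rule has_integral_eq[rotated]) (simp add: powr_realpow)
  thus ?thesis by (simp add: has_integral_Icc_iff_Ioo)
qed

lemma fact_mult_pochhammer_of_nat_Suc: "fact p * pochhammer (of_nat (Suc p) :: complex) k = fact (p + k)"
proof (induction k)
  case (Suc k)
  have "fact p * pochhammer (of_nat (Suc p)) (Suc k)
      = (fact p * pochhammer (of_nat (Suc p) :: complex) k) * of_nat (Suc (p + k))"
    by (simp add: pochhammer_Suc add_ac)
  also have "\<dots> = fact (p + Suc k)"
    unfolding Suc.IH by (simp add: mult.commute)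
  finally show ?case .
qed simp

text \<open>Expand the exponential and integrate term by term: the \<open>k\<close>-th term gives a beta integral with
  parameters \<open>p + k + 1\<close> and \<open>q + 1\<close>, which contributes the quotient of Pochhammer symbols.\<close>
lemma has_integral_kummer_Phi:
  "((\<lambda>t::real. of_real (t ^ p * (1 - t) ^ q) * exp (of_real t * w)) has_integral
      (fact p * fact q / fact (p + q + 1)) * kummer_Phi (of_nat (p + 1)) (of_nat (p + q + 2)) w) {0..1}"
proof -
  define f where "f i t = of_real (t ^ p * (1 - t) ^ q) * ((of_real t * w) ^ i /\<^sub>R fact i)"
    for i and t :: real
  define C :: complex where "C = fact p * fact q / fact (p + q + 1)"
  define k where "k i = pochhammer (of_nat (p + 1)) i / pochhammer (of_nat (p + q + 2)) i * (w ^ i / fact i)" for i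
  have f_int: "(f i has_integral C * k i) {0..1}" for i
  proof -
    have "((\<lambda>t. of_real (t ^ (p + i) * (1 - t) ^ q) * (w ^ i / fact i)) has_integral
            of_real (fact (p + i) * fact q / fact (p + i + q + 1)) * (w ^ i / fact i)) {0..1}"
      by (intro has_integral_mult_left has_integral_of_real has_integral_beta_power)
    moreover have "C * k i = of_real (fact (p + i) * fact q / fact (p + i + q + 1)) * (w ^ i / fact i)"
    proof -
      have e1: "(fact (p + i) :: complex) = fact p * pochhammer (of_nat (p + 1)) i"
        using fact_mult_pochhammer_of_nat_Suc[of p i] by simp
      have e2: "(fact (p + i + q + 1) :: complex) = fact (p + q + 1) * pochhammer (of_nat (p + q + 2)) i"
        using fact_mult_pochhammer_of_nat_Suc[of "p + q + 1" i] by (simp add: add_ac)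
      show ?thesis
        unfolding C_def k_def of_real_divide of_real_mult of_real_fact e1 e2 times_divide_times_eq
        by (simp only: mult_ac)
    qed
    ultimately show ?thesis
      by (simp add: f_def[abs_def] power_mult_distrib power_add scaleR_conv_of_real divide_inverse mult_ac)
  qed
  have "uniform_limit {0..1} (\<lambda>n t. \<Sum>i<n. f i t) (\<lambda>t. suminf (\<lambda>i. f i t)) sequentially"
  proof (rule Weierstrass_m_test)
    show "summable (\<lambda>i. norm w ^ i /\<^sub>R fact i)" by (rule summable_exp_generic)
    fix i :: nat and t :: real assume t: "t \<in> {0..1}"
    have "norm (f i t) = (t ^ p * (1 - t) ^ q * t ^ i) * (norm w ^ i /\<^sub>R fact i)"
      using t by (simp add: f_def norm_mult norm_power power_mult_distrib abs_mult power_abs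
                    del: of_real_mult of_real_power of_real_diff)
    also have "\<dots> \<le> 1 * (norm w ^ i /\<^sub>R fact i)"
      using t by (intro mult_right_mono mult_le_one power_le_one) auto
    finally show "norm (f i t) \<le> norm w ^ i /\<^sub>R fact i" by simp
  qed
  moreover have "suminf (\<lambda>i. f i t) = of_real (t ^ p * (1 - t) ^ q) * exp (of_real t * w)" for t
    unfolding f_def exp_def by (rule suminf_mult[OF summable_exp_generic])
  ultimately have "uniform_limit {0..1} (\<lambda>n t. \<Sum>i<n. f i t)
      (\<lambda>t. of_real (t ^ p * (1 - t) ^ q) * exp (of_real t * w)) sequentially"
    by simp
  then obtain I J where I: "\<And>n. ((\<lambda>t. \<Sum>i<n. f i t) has_integral I n) {0..1}"
      and J: "((\<lambda>t. of_real (t ^ p * (1 - t) ^ q) * exp (of_real t * w)) has_integral J) {0..1}"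
      and IJ: "I \<longlonglongrightarrow> J"
    by (rule uniform_limit_integral) (auto simp: f_def intro!: continuous_intros)
  have "I = (\<lambda>n. \<Sum>i<n. C * k i)"
  proof
    fix n show "I n = (\<Sum>i<n. C * k i)"
      using I[of n] has_integral_sum[of "{..<n}" f "\<lambda>i. C * k i" "{0..1}"] f_int
      by (auto intro: has_integral_unique)
  qed
  hence "(\<lambda>i. C * k i) sums J" using IJ by (simp add: sums_def)
  moreover have "C \<noteq> 0" unfolding C_def by (simp del: fact_Suc add_Suc_right One_nat_def)
  ultimately have "k sums (J / C)" using sums_divide[of "\<lambda>i. C * k i" J C] by simp
  hence "kummer_Phi (of_nat (p + 1)) (of_nat (p + q + 2)) w = J / C"
    unfolding kummer_Phi_def k_def by (simp add: sums_iff)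
  hence "J = C * kummer_Phi (of_nat (p + 1)) (of_nat (p + q + 2)) w" using \<open>C \<noteq> 0\<close> by simp
  thus ?thesis using J unfolding C_def by simp
qed

text \<open>The weights \<open>\<alpha>\<close> and \<open>\<beta>\<close> are the beta integrals that belong to the two summands of
  \<open>1 - A t = (1 - A) + A (1 - t)\<close>, divided by \<open>(m - 1)!\<close>.\<close>
lemma char_Delta_conv_comb_F:
  assumes "n \<ge> 1" "m \<ge> 1"
  shows "char_Delta n m \<tau> s0 A s = of_real \<tau> ^ m * (s - of_real s0) ^ (n + m) *
    comb_F (of_nat m) (of_nat (n + m))
      (of_real ((1 - A) * fact (n - 1) / fact (n + m - 1))) (of_real (A * fact n / fact (n + m)))
      (- (of_real \<tau> * (s - of_real s0)))"
proof -
  define p q where "p = m - 1" and "q = n - 1"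
  have mn: "m = Suc p" "n = Suc q" using assms by (simp_all add: p_def q_def)
  define w where "w = - (of_real \<tau> * (s - of_real s0))"
  have "((\<lambda>t::real. of_real (1 - A) * (of_real (t ^ p * (1 - t) ^ q) * exp (of_real t * w))
            + of_real A * (of_real (t ^ p * (1 - t) ^ Suc q) * exp (of_real t * w))) has_integral
      of_real (1 - A) * ((fact p * fact q / fact (p + q + 1)) * kummer_Phi (of_nat (p + 1)) (of_nat (p + q + 2)) w)
      + of_real A * ((fact p * fact (Suc q) / fact (p + Suc q + 1)) * kummer_Phi (of_nat (p + 1)) (of_nat (p + Suc q + 2)) w)) {0..1}"
    by (intro has_integral_add has_integral_mult_right has_integral_kummer_Phi)
  moreover have "of_real (1 - A) * (of_real (t ^ p * (1 - t) ^ q) * exp (of_real t * w))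
            + of_real A * (of_real (t ^ p * (1 - t) ^ Suc q) * exp (of_real t * w))
      = of_real (t ^ p * (1 - t) ^ q * (1 - A * t)) * exp (- (of_real t * of_real \<tau> * (s - of_real s0)))"
    for t :: real
  proof -
    have "of_real (1 - A) * (of_real x * e) + of_real A * (of_real (x * (1 - t)) * e)
       = of_real (x * (1 - A * t)) * (e :: complex)" for x e
      by (simp add: algebra_simps)
    moreover have "of_real t * w = - (of_real t * of_real \<tau> * (s - of_real s0))"
      by (simp add: w_def)
    moreover have "t ^ p * (1 - t) ^ Suc q = t ^ p * (1 - t) ^ q * (1 - t)" by simp
    ultimately show ?thesis by metis
  qed
  ultimately have "integral {0..1} (\<lambda>t::real. of_real (t ^ p * (1 - t) ^ q * (1 - A * t)) *
       exp (- (of_real t * of_real \<tau> * (s - of_real s0)))) =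
      of_real (1 - A) * ((fact p * fact q / fact (p + q + 1)) * kummer_Phi (of_nat (p + 1)) (of_nat (p + q + 2)) w)
      + of_real A * ((fact p * fact (Suc q) / fact (p + Suc q + 1)) * kummer_Phi (of_nat (p + 1)) (of_nat (p + Suc q + 2)) w)"
    by (simp add: integral_unique)
  also have "\<dots> = fact p * comb_F (of_nat m) (of_nat (n + m))
      (of_real ((1 - A) * fact (n - 1) / fact (n + m - 1))) (of_real (A * fact n / fact (n + m))) w"
  proof -
    have idx: "q = n - 1" "Suc (n - 1) = n" "p + n + 1 = n + m" "p + (n - 1) + 1 = n + m - 1"
      "p + (n - 1) + 2 = n + m" "p + 1 = m" "p + n + 2 = n + m + 1" using mn by auto
    show ?thesis
      unfolding idx comb_F_def of_real_divide of_real_mult of_real_fact of_nat_add[of "n + m" 1] of_nat_1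
      by (simp add: algebra_simps)
  qed
  finally show ?thesis
    unfolding char_Delta_def w_def[symmetric] p_def[symmetric] q_def[symmetric] by simp
qed

text \<open>The value \<open>\<alpha> + \<beta>\<close> and the derivative \<open>a (\<alpha> / b + \<beta> / (b + 1))\<close> at the origin determine \<open>\<alpha>\<close>
  and \<open>\<beta>\<close>.\<close>
lemma comb_F_not_identically_zero:
  assumes "a \<noteq> 0" "b \<noteq> 0" "b + 1 \<noteq> 0" "\<alpha> \<noteq> 0 \<or> \<beta> \<noteq> 0"
  shows "\<exists>w. comb_F a b \<alpha> \<beta> w \<noteq> 0"
proof (rule ccontr)
  assume "\<not> ?thesis"
  hence zero: "comb_F a b \<alpha> \<beta> = (\<lambda>_. 0)" by auto
  have at0: "kummer_Phi a c 0 = 1" "(kummer_Phi a c has_field_derivative a / c) (at 0)" for c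
  proof -
    show "kummer_Phi a c 0 = 1"
      by (simp add: kummer_Phi_conv_eval_fps eval_fps_at_0 kummer_fps_def)
    have "(eval_fps (kummer_fps a c) has_field_derivative eval_fps (fps_deriv (kummer_fps a c)) 0) (at 0)"
      by (rule has_field_derivative_eval_fps) simp
    thus "(kummer_Phi a c has_field_derivative a / c) (at 0)"
      by (simp add: kummer_Phi_conv_eval_fps eval_fps_at_0 kummer_fps_def)
  qed
  have "\<alpha> + \<beta> = 0" using fun_cong[OF zero, of 0] by (simp add: comb_F_def at0)
  have "(comb_F a b \<alpha> \<beta> has_field_derivative \<alpha> * (a / b) + \<beta> * (a / (b + 1))) (at 0)"
    unfolding comb_F_def[abs_def] by (intro DERIV_add DERIV_cmult at0)
  hence "\<alpha> * (a / b) + \<beta> * (a / (b + 1)) = 0"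
    unfolding zero by (rule DERIV_unique) simp
  hence "a * (\<alpha> * (b + 1) + \<beta> * b) = 0" using assms by (simp add: field_simps)
  hence "\<alpha> * (b + 1) + \<beta> * b = 0" using \<open>a \<noteq> 0\<close> by simp
  with \<open>\<alpha> + \<beta> = 0\<close> have "\<alpha> = 0" "\<beta> = 0" by algebra+
  with assms show False by simp
qed

text \<open>The multiplicity of \<open>s\<^sub>0\<close> is \<open>n + m \<ge> 2\<close> plus that of \<open>0\<close> as a root of \<open>F\<close>. The latter is positive for
  \<open>A = (n + m) / m\<close>.\<close>
theorem theorem10:
  fixes n m :: nat and \<tau> s0 A :: real and a b \<alpha> \<beta> :: complex
  assumes "n \<ge> 1" and "m \<ge> 1" and "\<tau> > 0"
    and "a = of_nat m"
    and "b = of_nat (n + m)"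
    and "\<alpha> = of_real ((1 - A) * fact (n - 1) / fact (n + m - 1))"
    and "\<beta> = of_real (A * fact n / fact (n + m))"
    and "\<And>(t::real) z. 0 < t \<Longrightarrow> t < 1 \<Longrightarrow> comb_F a b \<alpha> \<beta> z = 0 \<Longrightarrow> Re z < 0 \<Longrightarrow>
           of_real t * z \<in> coeff_dom a b \<alpha> \<beta> \<and>
           Re (z * coeff_G a b \<alpha> \<beta> (of_real t * z)) \<ge> 0"
  shows "dominant_root (char_Delta n m \<tau> s0 A) (of_real s0) \<and>
         MID_property (char_Delta n m \<tau> s0 A) (of_real s0)"
proof -
  define h where "h s = of_real \<tau> ^ m * comb_F a b \<alpha> \<beta> (- (of_real \<tau> * (s - of_real s0)))" for s
  have Delta: "char_Delta n m \<tau> s0 A = (\<lambda>s. (s - of_real s0) ^ (n + m) * h s)"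
    using char_Delta_conv_comb_F[OF assms(1,2)] by (simp add: fun_eq_iff h_def assms)
  have b_real: "b = of_real (real (n + m))" using assms by simp
  have "real (n + m) \<noteq> 0" "real (n + m) + 1 \<noteq> 0" using assms(1) by linarith+
  hence "b \<noteq> 0" "b + 1 \<noteq> 0"
    unfolding b_real by (metis of_real_0 of_real_1 of_real_add of_real_eq_iff)+
  moreover have "a \<noteq> 0" using assms(2,4) by simp
  moreover have "\<alpha> \<noteq> 0 \<or> \<beta> \<noteq> 0" using assms(6,7) by (cases "A = 0") auto
  ultimately obtain w0 where w0: "comb_F a b \<alpha> \<beta> w0 \<noteq> 0"
    using comb_F_not_identically_zero by blast
  have no_root: "comb_F a b \<alpha> \<beta> z \<noteq> 0" if "Re z < 0" for z
    using comb_F_no_left_root[of "real (n + m)" a \<alpha> \<beta> w0 z, folded b_real] assms(1,2,8) w0 that by auto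
  have dominant: "dominant_root (char_Delta n m \<tau> s0 A) (of_real s0)"
    unfolding dominant_root_def
  proof (intro conjI allI impI)
    show "char_Delta n m \<tau> s0 A (of_real s0) = 0" using assms(1) by (simp add: Delta)
    fix s assume root: "char_Delta n m \<tau> s0 A s = 0"
    show "Re s \<le> Re (of_real s0)"
    proof (rule ccontr)
      assume gt: "\<not> ?thesis"
      hence "Re (- (of_real \<tau> * (s - of_real s0))) < 0" using \<open>\<tau> > 0\<close> by simp
      from no_root[OF this] have "h s \<noteq> 0" using \<open>\<tau> > 0\<close> by (simp add: h_def)
      thus False using root gt by (auto simp: Delta)
    qed
  qed
  have h_hol: "h holomorphic_on UNIV"
  proof -
    have "(comb_F a b \<alpha> \<beta> \<circ> (\<lambda>s. - (of_real \<tau> * (s - of_real s0)))) holomorphic_on UNIV"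
      by (rule holomorphic_on_compose_gen[where t = UNIV])
         (auto intro!: holomorphic_intros comb_F_holomorphic)
    thus ?thesis unfolding h_def[abs_def] o_def by (intro holomorphic_intros)
  qed
  hence h_an: "h analytic_on {of_real s0}" using analytic_at by blast
  have "h (of_real s0 - w0 / of_real \<tau>) \<noteq> 0" using w0 \<open>\<tau> > 0\<close> by (simp add: h_def)
  hence h_ev: "eventually (\<lambda>s. h s \<noteq> 0) (at (of_real s0))"
    using non_zero_neighbour_alt[OF h_hol, of "of_real s0"] by (auto elim: eventually_mono)
  have ev: "eventually (\<lambda>s. (s - of_real s0) ^ (n + m) * h s \<noteq> 0) (at (of_real s0))"
    using h_ev eventually_neq_at_within[of "of_real s0"] by eventually_elim auto
  have "zorder (\<lambda>s. (s - of_real s0) ^ (n + m) * h s) (of_real s0)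
      = zorder (\<lambda>s. (s - of_real s0) ^ (n + m)) (of_real s0) + zorder h (of_real s0)"
    by (intro zorder_times_analytic ev h_an analytic_intros)
  moreover have "zorder (\<lambda>s::complex. (s - of_real s0) ^ (n + m)) (of_real s0) = int (n + m)"
    by (rule zorder_eqI[where S = UNIV and g = "\<lambda>_. 1"]) (auto simp del: of_nat_add)
  moreover have "zorder h (of_real s0) \<ge> 0"
    using h_ev by (intro zorder_ge_0 h_an) (simp add: eventually_frequently)
  ultimately have "zorder (char_Delta n m \<tau> s0 A) (of_real s0) > 1"
    using assms(1,2) by (simp add: Delta)
  moreover have "\<exists>\<^sub>F s in at (of_real s0). char_Delta n m \<tau> s0 A s \<noteq> 0"
    using ev unfolding Delta by (intro eventually_frequently) auto
  ultimately show ?thesis using dominant by (simp add: MID_property_def)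
qed

end
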